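(* Let $n>1$, let $X_1<X_2<\dots<X_n$ be the ordered observations with empirical distribution function $\mathbb{F}_n$, and let $\hat\varphi_n$ be the log-concave maximum likelihood estimator of the log-density. Let $\widetilde\varphi:\mathbb{R}\to[-\infty,\infty)$ be a concave function such that $\{x:\widetilde\varphi(x)>-\infty\}=[X_1,X_n]$. Then $\widetilde\varphi=\hat\varphi_n$ if and only if $$\int \Delta(x)\,d\mathbb{F}_n(x)\le\int\Delta(x)\exp\widetilde\varphi(x)\,dx$$ for any $\Delta:\mathbb{R}\to\mathbb{R}$ such that $\widetilde\varphi+\lambda\Delta$ is concave for some $\lambda>0$.
   Context: $\mathbb{F}_n$ is the distribution function of the uniform distribution on $\{X_1,\dots,X_n\}$. For concave $\varphi:\mathbb{R}\to[-\infty,\infty)$ put $\Psi_n(\varphi):=\int\varphi\,d\mathbb{F}_n-\int_{\mathbb{R}}\exp\varphi(x)\,dx$, with $\exp(-\infty)=0$. The estimator $\hat\varphi_n$ is the maximizer of $\Psi_n$ over all concave functions $\mathbb{R}\to[-\infty,\infty)$. It is known that it exists, is unique, is linear on each $[X_j,X_{j+1}]$, $1\le j<n$, and equals $-\infty$ on $\mathbb{R}\setminus[X_1,X_n]$. Since $\exp\widetilde\varphi=0$ outside $[X_1,X_n]$, the integral on the right is effectively over $[X_1,X_n]$. *)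

theory Defs
  imports "HOL-Probability.Probability"
begin

text \<open>A function \<open>\<real> \<rightarrow> [-\<infinity>, \<infinity>)\<close> is a function into \<open>ereal\<close> omitting \<open>\<infinity>\<close>. The weight ranges
  over the open unit interval, because \<open>0 * (-\<infinity>) = 0\<close> in \<open>ereal\<close>.\<close>

definition concave_ext :: "(real \<Rightarrow> ereal) \<Rightarrow> bool" where
  "concave_ext \<phi> \<longleftrightarrow>
     (\<forall>x. \<phi> x \<noteq> \<infinity>) \<and>
     (\<forall>x y. \<forall>t\<in>{0<..<1}. ereal (1 - t) * \<phi> x + ereal t * \<phi> y \<le> \<phi> ((1 - t) * x + t * y))"

text \<open>The value at \<open>\<infinity>\<close> is a dummy; it is only applied to values \<open>< \<infinity>\<close>.\<close>

definition exp_ext :: "ereal \<Rightarrow> real" where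
  "exp_ext y = (if y = -\<infinity> then 0 else exp (real_of_ereal y))"

text \<open>The integral of an extended-real function, as the integral of its positive part minus that of
  its negative part (\<open>e2ennreal\<close> sends negative values to \<open>0\<close>). It is meaningful unless both parts
  are infinite; below the positive part is always finite.\<close>

definition ereal_integral :: "'a measure \<Rightarrow> ('a \<Rightarrow> ereal) \<Rightarrow> ereal" where
  "ereal_integral M f =
     enn2ereal (\<integral>\<^sup>+ x. e2ennreal (f x) \<partial>M) - enn2ereal (\<integral>\<^sup>+ x. e2ennreal (- f x) \<partial>M)"

text \<open>The law with distribution function \<open>\<F>\<^sub>n\<close>; an integral \<open>d\<F>\<^sub>n\<close> is one against this measure.\<close>

definition empirical :: "nat \<Rightarrow> (nat \<Rightarrow> real) \<Rightarrow> real measure" where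
  "empirical n X = measure_pmf (pmf_of_set (X ` {1..n}))"

text \<open>The second integral may be \<open>\<infinity>\<close>, so the criterion takes values in \<open>[-\<infinity>, \<infinity>)\<close>.\<close>

definition log_lik :: "nat \<Rightarrow> (nat \<Rightarrow> real) \<Rightarrow> (real \<Rightarrow> ereal) \<Rightarrow> ereal" where
  "log_lik n X \<phi> =
     ereal_integral (empirical n X) \<phi> - enn2ereal (\<integral>\<^sup>+ x. ennreal (exp_ext (\<phi> x)) \<partial>lborel)"

definition is_log_concave_mle :: "nat \<Rightarrow> (nat \<Rightarrow> real) \<Rightarrow> (real \<Rightarrow> ereal) \<Rightarrow> bool" where
  "is_log_concave_mle n X \<phi> \<longleftrightarrow>
     concave_ext \<phi> \<and> (\<forall>\<psi>. concave_ext \<psi> \<longrightarrow> log_lik n X \<psi> \<le> log_lik n X \<phi>)"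

end

theory Submission
  imports Defs
begin

text \<open>A maximizer must be finite at every observation, and it must be \<open>-\<infinity>\<close> outside
  \<open>[X\<^sub>1, X\<^sub>n]\<close>, since mass there only increases the integral of \<open>exp \<phi>\<close>. So the problem lives on
  real concave functions on \<open>[X\<^sub>1, X\<^sub>n]\<close>, where the criterion is concave and the inequality for
  \<open>\<Delta>\<close> is the first-order condition. It is necessary by \<open>exp u \<le> 1 + u + u\<^sup>2\<close> for small \<open>u\<close>.
  Conversely, for \<open>\<Delta> = \<phi>hat - \<phi>tilde\<close> the strict inequality \<open>1 + u < exp u\<close> for \<open>u \<noteq> 0\<close> forces
  the two functions to agree almost everywhere, hence on the open interval. They may still jump at
  the end points: their maximum \<open>m\<close> is again concave, so maximality of \<open>\<phi>hat\<close> gives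
  \<open>m = \<phi>hat\<close> at the observations, and the condition with \<open>\<Delta> = m - \<phi>tilde\<close> gives
  \<open>m = \<phi>tilde\<close> there.\<close>

section \<open>Extended-real concave functions as real concave functions on a convex domain\<close>

definition ext_on :: "real set \<Rightarrow> (real \<Rightarrow> real) \<Rightarrow> real \<Rightarrow> ereal" where
  "ext_on S f x = (if x \<in> S then ereal (f x) else -\<infinity>)"

lemma ext_on_cong: "(\<And>x. x \<in> S \<Longrightarrow> f x = g x) \<Longrightarrow> ext_on S f = ext_on S g"
  by (auto simp: ext_on_def)

lemma concave_ext_ext_on:
  assumes "convex S"
  shows "concave_ext (ext_on S f) \<longleftrightarrow> concave_on S f"
proof
  assume c: "concave_ext (ext_on S f)"
  show "concave_on S f"
    unfolding concave_on_def
  proof (rule convex_onI)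
    fix t x y :: real
    assume t: "0 < t" "t < 1" and xy: "x \<in> S" "y \<in> S"
    have z: "(1 - t) * x + t * y \<in> S"
      using convexD[OF assms xy, of "1 - t" t] t by simp
    have "ereal (1 - t) * ext_on S f x + ereal t * ext_on S f y \<le> ext_on S f ((1 - t) * x + t * y)"
      using c t by (simp add: concave_ext_def)
    then show "- f ((1 - t) *\<^sub>R x + t *\<^sub>R y) \<le> (1 - t) * - f x + t * - f y"
      using z xy by (simp add: ext_on_def)
  qed (rule assms)
next
  assume c: "concave_on S f"
  show "concave_ext (ext_on S f)"
    unfolding concave_ext_def
  proof (intro conjI allI ballI)
    fix x y t :: real
    assume t: "t \<in> {0<..<1}"
    show "ereal (1 - t) * ext_on S f x + ereal t * ext_on S f y \<le> ext_on S f ((1 - t) * x + t * y)"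
    proof (cases "x \<in> S \<and> y \<in> S")
      case True
      have "(1 - t) * x + t * y \<in> S"
        using convexD[OF assms, of x y "1 - t" t] t True by simp
      then show ?thesis
        using concave_onD[OF c, of t x y] t True by (simp add: ext_on_def)
    next
      case False
      \<comment> \<open>Both weights are positive, so the value \<open>-\<infinity>\<close> survives
        multiplication, and the other summand is never \<open>\<infinity>\<close>.\<close>
      then have eq: "ereal (1 - t) * ext_on S f x + ereal t * ext_on S f y = -\<infinity>"
        using t by (auto simp: ext_on_def)
      show ?thesis unfolding eq by simp
    qed
  qed (simp add: ext_on_def)
qed

lemma concave_ext_convex_dom:
  assumes "concave_ext \<phi>"
  shows "convex {x. \<phi> x > -\<infinity>}"
  unfolding convex_alt
proof (intro ballI allI impI)
  fix x y u :: real
  assume xy: "x \<in> {x. \<phi> x > -\<infinity>}" "y \<in> {x. \<phi> x > -\<infinity>}" and u: "0 \<le> u \<and> u \<le> 1"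
  have fin: "\<phi> x \<noteq> \<infinity>" "\<phi> y \<noteq> \<infinity>" using assms by (auto simp: concave_ext_def)
  \<comment> \<open>\<open>concave_ext\<close> speaks of weights in the open unit interval only, so
    the two end weights are treated apart.\<close>
  consider "u = 0" | "u = 1" | "u \<in> {0<..<1}" using u by force
  then show "(1 - u) *\<^sub>R x + u *\<^sub>R y \<in> {x. \<phi> x > -\<infinity>}"
  proof cases
    case 3
    then have "ereal (1 - u) * \<phi> x + ereal u * \<phi> y \<le> \<phi> ((1 - u) * x + u * y)"
      using assms by (simp add: concave_ext_def)
    moreover have "ereal (1 - u) * \<phi> x + ereal u * \<phi> y > -\<infinity>"
      using xy fin by (cases "\<phi> x"; cases "\<phi> y") auto
    ultimately show ?thesis by auto
  qed (use xy in auto)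
qed

lemma concave_ext_eq_ext_on:
  assumes "concave_ext \<phi>"
  shows "\<phi> = ext_on {x. \<phi> x > -\<infinity>} (\<lambda>x. real_of_ereal (\<phi> x))"
proof
  fix x
  have "\<phi> x \<noteq> \<infinity>" using assms by (simp add: concave_ext_def)
  then show "\<phi> x = ext_on {x. \<phi> x > -\<infinity>} (\<lambda>x. real_of_ereal (\<phi> x)) x"
    by (cases "\<phi> x") (auto simp: ext_on_def)
qed

lemma concave_extE:
  assumes "concave_ext \<phi>"
  obtains f where "\<phi> = ext_on {x. \<phi> x > -\<infinity>} f" "concave_on {x. \<phi> x > -\<infinity>} f"
  using concave_ext_eq_ext_on[OF assms] concave_ext_ext_on[OF concave_ext_convex_dom[OF assms]] assms
  by metis

section \<open>Concave functions on a compact interval: bounds, continuity, measurability\<close>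

lemma concave_on_interval_ge_min:
  fixes f :: "real \<Rightarrow> real"
  assumes "concave_on {a..b} f" "x \<in> {a..b}"
  shows "min (f a) (f b) \<le> f x"
proof (cases "a = b")
  case False
  define t where "t = (x - a) / (b - a)"
  have ab: "a < b" using assms False by auto
  have t: "0 \<le> t" "t \<le> 1" using assms(2) ab by (auto simp: t_def)
  have "t * (b - a) = x - a" using ab by (simp add: t_def)
  then have "(1 - t) * a + t * b = x" by (simp add: algebra_simps)
  then have "(1 - t) * f a + t * f b \<le> f x"
    using concave_onD[OF assms(1) t, of a b] ab by simp
  moreover have "(1 - t) * min (f a) (f b) + t * min (f a) (f b) \<le> (1 - t) * f a + t * f b"
    using t by (intro add_mono mult_left_mono) auto
  ultimately show ?thesis by (simp add: algebra_simps)
qed (use assms in auto)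

text \<open>Below, the smaller end value is a bound. Above, \<open>x\<close> and its reflection
  \<open>a + b - x\<close> average to the midpoint, so \<open>f x\<close> is at most twice the
  midpoint value minus the lower bound at the reflected point.\<close>

lemma concave_on_interval_bounded:
  fixes f :: "real \<Rightarrow> real"
  assumes "concave_on {a..b} f"
  obtains B where "\<And>x. x \<in> {a..b} \<Longrightarrow> \<bar>f x\<bar> \<le> B"
proof -
  define m where "m = min (f a) (f b)"
  define M where "M = 2 * f ((a + b) / 2) - m"
  have "\<bar>f x\<bar> \<le> \<bar>m\<bar> + \<bar>M\<bar>" if x: "x \<in> {a..b}" for x
  proof -
    have refl: "a + b - x \<in> {a..b}" using x by auto
    have "(f x + f (a + b - x)) / 2 \<le> f ((a + b) / 2)"
      using concave_onD[OF assms, of "1/2" x "a + b - x"] x refl by (simp add: field_simps)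
    moreover have "m \<le> f x" "m \<le> f (a + b - x)"
      using concave_on_interval_ge_min[OF assms] x refl by (auto simp: m_def)
    ultimately show ?thesis by (auto simp: M_def)
  qed
  then show thesis by (rule that)
qed

lemma concave_on_interval_continuous:
  fixes f :: "real \<Rightarrow> real"
  assumes "concave_on {a..b} f"
  shows "continuous_on {a<..<b} f"
proof -
  have "convex_on {a<..<b} (\<lambda>x. - f x)"
    using assms unfolding concave_on_def by (rule convex_on_subset) auto
  then show ?thesis
    using convex_on_continuous[of "{a<..<b}" "\<lambda>x. - f x"] continuous_on_minus by fastforce
qed

abbreviation lborel_on :: "real \<Rightarrow> real \<Rightarrow> real measure" where
  "lborel_on a b \<equiv> restrict_space lborel {a..b}"

text \<open>A concave function may jump at the end points, so \<open>f\<close> is patched together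
  from its continuous restriction to the open interval and two single values.\<close>

lemma concave_on_interval_measurable:
  fixes f :: "real \<Rightarrow> real"
  assumes "concave_on {a..b} f"
  shows "f \<in> borel_measurable (lborel_on a b)"
proof -
  have f1: "(\<lambda>x. indicator {a<..<b} x * f x) \<in> borel_measurable borel"
    using borel_measurable_continuous_on_indicator[OF _ concave_on_interval_continuous[OF assms]]
    by simp
  have "(\<lambda>x. indicator {a..b} x * f x) = (\<lambda>x. if x = a then indicator {a..b} a * f a else
      if x = b then indicator {a..b} b * f b else indicator {a<..<b} x * f x)"
    by (auto simp: indicator_def fun_eq_iff)
  also have "\<dots> \<in> borel_measurable borel"
    using f1 by measurable
  finally show ?thesis
    by (subst borel_measurable_restrict_space_iff) auto
qed

lemma finite_measure_lborel_on: "finite_measure (lborel_on a b)"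
  by (rule finite_measureI) (auto simp: space_restrict_space emeasure_restrict_space emeasure_lborel_Icc_eq)

lemma integrable_lborel_on:
  fixes f :: "real \<Rightarrow> real"
  assumes "f \<in> borel_measurable (lborel_on a b)" "\<And>x. x \<in> {a..b} \<Longrightarrow> \<bar>f x\<bar> \<le> B"
  shows "integrable (lborel_on a b) f"
proof (rule finite_measure.integrable_const_bound[OF finite_measure_lborel_on _ assms(1)])
  show "AE x in lborel_on a b. norm (f x) \<le> B"
    using assms(2) by (intro AE_I2) (simp add: space_restrict_space)
qed

lemma integrable_exp_concave:
  assumes "concave_on {a..b} f"
  shows "integrable (lborel_on a b) (\<lambda>x. exp (f x))"
proof -
  note [measurable] = concave_on_interval_measurable[OF assms]
  obtain B where B: "\<And>x. x \<in> {a..b} \<Longrightarrow> \<bar>f x\<bar> \<le> B"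
    using concave_on_interval_bounded[OF assms] by blast
  show ?thesis
    by (rule integrable_lborel_on[where B="exp B"]) (use B abs_le_D1 in auto)
qed

text \<open>The set where the functions differ is open in the open interval, and a nonempty open set
  is never a null set.\<close>

lemma continuous_AE_eq_on_interval:
  fixes f g :: "real \<Rightarrow> real"
  assumes "continuous_on {a<..<b} f" "continuous_on {a<..<b} g"
    and "AE x in lborel_on a b. f x = g x" and "x \<in> {a<..<b}"
  shows "f x = g x"
proof (rule ccontr)
  assume ne: "f x \<noteq> g x"
  define U where "U = {a<..<b} \<inter> (\<lambda>x. f x - g x) -` (-{0})"
  have "x \<in> U" using ne assms(4) by (simp add: U_def)
  have "open U"
    unfolding U_def
    by (intro continuous_open_preimage continuous_on_diff assms) auto
  have "AE x in lborel. x \<in> {a..b} \<longrightarrow> f x = g x"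
    using assms(3) AE_restrict_space_iff[of "{a..b}" lborel "\<lambda>x. f x = g x"] by simp
  then have "AE x in lborel. x \<notin> U"
    by eventually_elim (auto simp: U_def)
  then have "U \<in> null_sets lborel"
    using \<open>open U\<close> by (subst AE_iff_null_sets) auto
  then have "negligible U"
    by (simp add: negligible_iff_null_sets null_sets_completionI)
  then show False
    using open_not_negligible[OF \<open>open U\<close>] \<open>x \<in> U\<close> by blast
qed

section \<open>Evaluating the extended-real integrals of the criterion\<close>

lemma nn_integral_exp_ext_on:
  assumes "concave_on {a..b} f"
  shows "(\<integral>\<^sup>+x. ennreal (exp_ext (ext_on {a..b} f x)) \<partial>lborel) = ennreal (\<integral>x. exp (f x) \<partial>lborel_on a b)"
proof -
  have "ennreal (\<integral>x. exp (f x) \<partial>lborel_on a b) = (\<integral>\<^sup>+x. ennreal (exp (f x)) \<partial>lborel_on a b)"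
    using integrable_exp_concave[OF assms] by (simp add: nn_integral_eq_integral)
  also have "\<dots> = (\<integral>\<^sup>+x. ennreal (exp (f x)) * indicator {a..b} x \<partial>lborel)"
    by (subst nn_integral_restrict_space) auto
  also have "\<dots> = (\<integral>\<^sup>+x. ennreal (exp_ext (ext_on {a..b} f x)) \<partial>lborel)"
    by (intro nn_integral_cong) (auto simp: exp_ext_def ext_on_def indicator_def)
  finally show ?thesis ..
qed

lemma nn_integral_e2ennreal_finite:
  assumes "finite (set_pmf p)" "\<And>x. x \<in> set_pmf p \<Longrightarrow> f x \<noteq> (\<infinity>::ereal)"
  shows "(\<integral>\<^sup>+x. e2ennreal (f x) \<partial>measure_pmf p) < \<infinity>"
proof -
  have "e2ennreal (f x) < \<infinity>" if "x \<in> set_pmf p" for x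
    using assms(2)[OF that] by (cases "f x") (auto simp: e2ennreal_neg)
  then show ?thesis
    by (auto simp: nn_integral_measure_pmf_finite[OF assms(1)] assms(1) ennreal_mult_less_top pmf_nonneg)
qed

lemma ereal_integral_pmf_real:
  assumes "finite (set_pmf p)" "\<And>x. x \<in> set_pmf p \<Longrightarrow> f x = ereal (g x)"
  shows "ereal_integral (measure_pmf p) f = ereal (\<integral>x. g x \<partial>measure_pmf p)"
proof -
  have int: "integrable (measure_pmf p) g" by (rule integrable_measure_pmf_finite[OF assms(1)])
  have 1: "(\<integral>\<^sup>+x. e2ennreal (f x) \<partial>measure_pmf p) = (\<integral>\<^sup>+x. ennreal (g x) \<partial>measure_pmf p)"
    by (intro nn_integral_cong_AE) (simp add: AE_measure_pmf_iff assms(2))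
  have 2: "(\<integral>\<^sup>+x. e2ennreal (- f x) \<partial>measure_pmf p) = (\<integral>\<^sup>+x. ennreal (- g x) \<partial>measure_pmf p)"
    by (intro nn_integral_cong_AE) (simp add: AE_measure_pmf_iff assms(2))
  have 3: "(\<integral>\<^sup>+x. ennreal (g x) \<partial>measure_pmf p) < \<infinity>" "(\<integral>\<^sup>+x. ennreal (- g x) \<partial>measure_pmf p) < \<infinity>"
    using int by (auto simp: real_integrable_def top.not_eq_extremum)
  then show ?thesis
    unfolding ereal_integral_def 1 2 real_lebesgue_integral_def[OF int]
    by (simp flip: enn2ereal_ennreal ereal_minus(1))
qed

text \<open>An atom with value \<open>-\<infinity>\<close> has positive mass and makes the negative
  part infinite; the positive part is a finite sum of finite terms, so no difference of infinities
  arises.\<close>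

lemma ereal_integral_pmf_minus_infty:
  assumes "finite (set_pmf p)" "\<And>x. x \<in> set_pmf p \<Longrightarrow> f x \<noteq> \<infinity>" "x \<in> set_pmf p" "f x = -\<infinity>"
  shows "ereal_integral (measure_pmf p) f = -\<infinity>"
proof -
  have "(\<integral>\<^sup>+x. e2ennreal (- f x) \<partial>measure_pmf p) = \<infinity>"
    using assms(1,3,4)
    by (auto simp: nn_integral_measure_pmf_finite ennreal_mult_eq_top_iff pmf_eq_0_set_pmf
        intro!: bexI[of _ x])
  moreover have "(\<integral>\<^sup>+x. e2ennreal (f x) \<partial>measure_pmf p) < \<infinity>"
    by (rule nn_integral_e2ennreal_finite[OF assms(1,2)])
  ultimately show ?thesis
    unfolding ereal_integral_def
    by (cases "\<integral>\<^sup>+x. e2ennreal (f x) \<partial>measure_pmf p") auto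
qed

section \<open>A quadratic bound on the exponential, and maxima of concave functions\<close>

lemma exp_le_quadratic:
  fixes u :: real
  assumes "\<bar>u\<bar> \<le> 1"
  shows "exp u \<le> 1 + u + u\<^sup>2"
proof (cases "u \<ge> 0")
  case False
  have "1 - u \<le> exp (- u)" using exp_ge_add_one_self[of "- u"] by simp
  \<comment> \<open>The product is \<open>1 - u ^ 3\<close>, and \<open>u\<close> is negative
    here.\<close>
  moreover have "1 \<le> (1 + u + u\<^sup>2) * (1 - u)"
  proof -
    have "u ^ 3 \<le> 0" using False by (simp add: power_less_zero_eq less_imp_le)
    then show ?thesis by (simp add: algebra_simps power2_eq_square power3_eq_cube)
  qed
  moreover have "0 \<le> 1 + u + u\<^sup>2" using assms by (auto simp: abs_le_iff intro: add_nonneg_nonneg)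
  ultimately have "1 \<le> (1 + u + u\<^sup>2) * exp (- u)"
    by (meson mult_left_mono order_trans)
  then have "1 * exp u \<le> (1 + u + u\<^sup>2) * exp (- u) * exp u"
    by (rule mult_right_mono) simp
  then show ?thesis by (simp add: mult.assoc flip: exp_add)
next
  case True
  then show ?thesis using exp_bound[of u] assms by simp
qed

text \<open>In general a maximum of concave functions is not concave. Here the two can differ only
  at the end points, and the maximum merely picks the larger value at each end.\<close>

lemma concave_on_max_if_eq_interior:
  fixes f g :: "real \<Rightarrow> real"
  assumes f: "concave_on {a..b} f" and g: "concave_on {a..b} g"
    and eq: "\<And>x. x \<in> {a<..<b} \<Longrightarrow> f x = g x"
  shows "concave_on {a..b} (\<lambda>x. max (f x) (g x))"
  unfolding concave_on_def
proof (rule convex_onI)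
  fix t x y :: real
  assume t: "0 < t" "t < 1" and x: "x \<in> {a..b}" and y: "y \<in> {a..b}"
  define h where "h = (\<lambda>x. max (f x) (g x))"
  define z where "z = (1 - t) * x + t * y"
  have "(1 - t) * h x + t * h y \<le> h z"
  proof (cases "x = y")
    case True
    then have "z = x" by (simp add: z_def algebra_simps)
    then show ?thesis using True by (simp add: algebra_simps)
  next
    case False
    have interior: "(1 - s) * p + s * q \<in> {a<..<b}"
      if "0 < s" "s < 1" "p \<in> {a..b}" "q \<in> {a..b}" "p < q" for s p q :: real
    proof -
      have "0 < s * (q - p)" "0 < (1 - s) * (q - p)" using that by auto
      moreover have "(1 - s) * p + s * q = p + s * (q - p)" "(1 - s) * p + s * q = q - (1 - s) * (q - p)"
        by (simp_all add: algebra_simps)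
      ultimately have "p < (1 - s) * p + s * q" "(1 - s) * p + s * q < q" by linarith+
      then show ?thesis using that by simp
    qed
    have z: "z \<in> {a<..<b}"
      using interior[of t x y] interior[of "1 - t" y x] t x y False
      by (cases "x < y") (auto simp: z_def algebra_simps)
    \<comment> \<open>The chord from x to y may mix an end value of f with one of g; half-way points towards z
       lie in the interior, where only one of the two end values is involved at a time.\<close>
    define u where "u = (x + z) / 2"
    define v where "v = (y + z) / 2"
    have half: "(k x' + k z) / 2 \<le> k ((x' + z) / 2)"
      if "concave_on {a..b} k" "x' \<in> {a..b}" for k :: "real \<Rightarrow> real" and x'
      using concave_onD[OF that(1), of "1/2" x' z] that(2) z by (simp add: field_simps)
    have uv: "u \<in> {a<..<b}" "v \<in> {a<..<b}" using x y z by (auto simp: u_def v_def)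
    have hu: "(h x + f z) / 2 \<le> f u"
      using half[OF f x] half[OF g x] eq[OF z] eq[OF uv(1)] by (auto simp: h_def u_def max_def)
    have hv: "(h y + f z) / 2 \<le> f v"
      using half[OF f y] half[OF g y] eq[OF z] eq[OF uv(2)] by (auto simp: h_def v_def max_def)
    \<comment> \<open>The weights that combine \<open>x\<close> and \<open>y\<close> to
      \<open>z\<close> also combine the half-way points to \<open>z\<close>. In the resulting
      inequality half of \<open>f z\<close> stands on the left; cancelling it leaves the chord
      inequality for \<open>h\<close>.\<close>
    have "(1 - t) * u + t * v = z" by (simp add: u_def v_def z_def field_simps)
    then have "(1 - t) * f u + t * f v \<le> f z"
      using concave_onD[OF f, of t u v] t uv by simp
    moreover have "(1 - t) * ((h x + f z) / 2) + t * ((h y + f z) / 2) \<le> (1 - t) * f u + t * f v"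
      using hu hv t by (intro add_mono mult_left_mono) auto
    ultimately have "(1 - t) * ((h x + f z) / 2) + t * ((h y + f z) / 2) \<le> f z" by linarith
    then have "(1 - t) * h x + t * h y \<le> f z" by (simp add: field_simps)
    then show ?thesis by (simp add: h_def)
  qed
  then show "- max (f ((1 - t) *\<^sub>R x + t *\<^sub>R y)) (g ((1 - t) *\<^sub>R x + t *\<^sub>R y))
      \<le> (1 - t) * - max (f x) (g x) + t * - max (f y) (g y)"
    by (simp add: h_def z_def)
qed simp

lemma pmf_integral_le_zero:
  fixes f :: "'a \<Rightarrow> real"
  assumes "finite (set_pmf p)" "\<And>x. 0 \<le> f x" "(\<integral>x. f x \<partial>measure_pmf p) \<le> 0" "x \<in> set_pmf p"
  shows "f x = 0"
proof -
  have "(\<integral>x. f x \<partial>measure_pmf p) = 0"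
    using assms(2,3) by (simp add: antisym integral_nonneg)
  then show ?thesis
    using integral_nonneg_eq_0_iff_AE[OF integrable_measure_pmf_finite[OF assms(1)], of f] assms(2,4)
    by (simp add: AE_measure_pmf_iff)
qed

section \<open>The first-order condition on a fixed interval\<close>

definition log_lik_on :: "real pmf \<Rightarrow> real \<Rightarrow> real \<Rightarrow> (real \<Rightarrow> real) \<Rightarrow> real" where
  "log_lik_on p a b f = (\<integral>x. f x \<partial>measure_pmf p) - (\<integral>x. exp (f x) \<partial>lborel_on a b)"

lemma integrable_mult_exp_concave:
  assumes f: "concave_on {a..b} f" and "d \<in> borel_measurable (lborel_on a b)"
    and d: "\<And>x. x \<in> {a..b} \<Longrightarrow> \<bar>d x\<bar> \<le> D"
  shows "integrable (lborel_on a b) (\<lambda>x. d x * exp (f x))"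
proof -
  note [measurable] = concave_on_interval_measurable[OF f] assms(2)
  obtain B where B: "\<And>x. x \<in> {a..b} \<Longrightarrow> \<bar>f x\<bar> \<le> B"
    using concave_on_interval_bounded[OF f] by blast
  show ?thesis
  proof (rule integrable_lborel_on)
    fix x assume x: "x \<in> {a..b}"
    have "\<bar>d x\<bar> * exp (f x) \<le> D * exp B"
      using d[OF x] B[OF x] by (intro mult_mono) auto
    then show "\<bar>d x * exp (f x)\<bar> \<le> D * exp B" by (simp add: abs_mult)
  qed measurable
qed

text \<open>A direction \<open>d\<close> need not be concave, but it is the difference of the
  concave functions \<open>f + d\<close> and \<open>f\<close> and inherits boundedness and
  measurability from them. Positivity of \<open>D\<close> allows division by it later.\<close>

lemma concave_perturbation_bounded_measurable:
  assumes f: "concave_on {a..b} f" and fd: "concave_on {a..b} (\<lambda>x. f x + d x)"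
  obtains D where "D > 0" "\<And>x. x \<in> {a..b} \<Longrightarrow> \<bar>d x\<bar> \<le> D" "d \<in> borel_measurable (lborel_on a b)"
proof -
  obtain B where B: "\<And>x. x \<in> {a..b} \<Longrightarrow> \<bar>f x\<bar> \<le> B"
    using concave_on_interval_bounded[OF f] by blast
  obtain C where C: "\<And>x. x \<in> {a..b} \<Longrightarrow> \<bar>f x + d x\<bar> \<le> C"
    using concave_on_interval_bounded[OF fd] by blast
  have "(\<lambda>x. f x + d x - f x) \<in> borel_measurable (lborel_on a b)"
    using concave_on_interval_measurable[OF f] concave_on_interval_measurable[OF fd]
    by (rule borel_measurable_diff[rotated])
  then have "d \<in> borel_measurable (lborel_on a b)" by simp
  moreover have "\<bar>d x\<bar> \<le> \<bar>B\<bar> + \<bar>C\<bar> + 1" if "x \<in> {a..b}" for x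
    using B[OF that] C[OF that] by linarith
  ultimately show thesis by (intro that[of "\<bar>B\<bar> + \<bar>C\<bar> + 1"]) auto
qed

text \<open>Maximality is tested against \<open>f + t * d\<close>. By the quadratic bound the
  second-order error is at most \<open>t\<^sup>2 * K\<close>; dividing by \<open>t\<close> and
  letting \<open>t\<close> tend to 0 gives the claim.\<close>

lemma maximizer_directional_derivative_le:
  assumes fin: "finite (set_pmf p)" and f: "concave_on {a..b} f"
    and max: "\<And>h. concave_on {a..b} h \<Longrightarrow> log_lik_on p a b h \<le> log_lik_on p a b f"
    and fd: "concave_on {a..b} (\<lambda>x. f x + d x)"
  shows "(\<integral>x. d x \<partial>measure_pmf p) \<le> (\<integral>x. d x * exp (f x) \<partial>lborel_on a b)"
proof -
  obtain D where D: "D > 0" "\<And>x. x \<in> {a..b} \<Longrightarrow> \<bar>d x\<bar> \<le> D"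
    and dm[measurable]: "d \<in> borel_measurable (lborel_on a b)"
    using concave_perturbation_bounded_measurable[OF f fd] by blast
  note intp = integrable_measure_pmf_finite[OF fin]
  define K where "K = (\<integral>x. (d x)\<^sup>2 * exp (f x) \<partial>lborel_on a b)"
  have K: "K \<ge> 0" unfolding K_def by (rule Bochner_Integration.integral_nonneg) simp
  have i0: "integrable (lborel_on a b) (\<lambda>x. exp (f x))" by (rule integrable_exp_concave[OF f])
  have i1: "integrable (lborel_on a b) (\<lambda>x. d x * exp (f x))"
    by (rule integrable_mult_exp_concave[OF f dm D(2)])
  have i2: "integrable (lborel_on a b) (\<lambda>x. (d x)\<^sup>2 * exp (f x))"
  proof (rule integrable_mult_exp_concave[OF f])
    fix x assume "x \<in> {a..b}"
    then show "\<bar>(d x)\<^sup>2\<bar> \<le> D\<^sup>2" using D by (simp add: abs_le_square_iff[symmetric])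
  qed measurable
  have step: "(\<integral>x. d x \<partial>measure_pmf p) \<le> (\<integral>x. d x * exp (f x) \<partial>lborel_on a b) + t * K"
    if t: "0 < t" "t \<le> 1" "t * D \<le> 1" for t
  proof -
    \<comment> \<open>\<open>f + t * d\<close> is a convex combination of \<open>f\<close> and
      \<open>f + d\<close>, hence an admissible competitor.\<close>
    have "concave_on {a..b} (\<lambda>x. (1 - t) * f x + t * (f x + d x))"
      using t by (intro concave_on_add concave_on_cmul f fd) auto
    then have c: "concave_on {a..b} (\<lambda>x. f x + t * d x)" by (simp add: algebra_simps)
    have "(\<integral>x. exp (f x + t * d x) \<partial>lborel_on a b)
        \<le> (\<integral>x. exp (f x) + t * (d x * exp (f x)) + t\<^sup>2 * ((d x)\<^sup>2 * exp (f x)) \<partial>lborel_on a b)"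
    proof (rule integral_mono)
      fix x assume "x \<in> space (lborel_on a b)"
      then have "\<bar>t * d x\<bar> \<le> t * D"
        using D(2)[of x] t by (simp add: space_restrict_space abs_mult)
      then have "exp (t * d x) \<le> 1 + t * d x + (t * d x)\<^sup>2"
        using t by (intro exp_le_quadratic) simp
      then have "exp (f x) * exp (t * d x) \<le> exp (f x) * (1 + t * d x + (t * d x)\<^sup>2)"
        by (rule mult_left_mono) simp
      then show "exp (f x + t * d x) \<le> exp (f x) + t * (d x * exp (f x)) + t\<^sup>2 * ((d x)\<^sup>2 * exp (f x))"
        by (simp add: exp_add algebra_simps power_mult_distrib)
    qed (use i0 i1 i2 integrable_exp_concave[OF c] in auto)
    also have "\<dots> = (\<integral>x. exp (f x) \<partial>lborel_on a b) + t * (\<integral>x. d x * exp (f x) \<partial>lborel_on a b) + t\<^sup>2 * K"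
      using i0 i1 i2 by (simp add: K_def)
    finally have "(\<integral>x. exp (f x + t * d x) \<partial>lborel_on a b)
        \<le> (\<integral>x. exp (f x) \<partial>lborel_on a b) + t * (\<integral>x. d x * exp (f x) \<partial>lborel_on a b) + t\<^sup>2 * K" .
    moreover have "(\<integral>x. f x + t * d x \<partial>measure_pmf p)
        = (\<integral>x. f x \<partial>measure_pmf p) + t * (\<integral>x. d x \<partial>measure_pmf p)"
      by (simp add: intp)
    ultimately have "t * (\<integral>x. d x \<partial>measure_pmf p) \<le> t * (\<integral>x. d x * exp (f x) \<partial>lborel_on a b) + t\<^sup>2 * K"
      using max[OF c] unfolding log_lik_on_def by linarith
    then have "t * (\<integral>x. d x \<partial>measure_pmf p) \<le> t * ((\<integral>x. d x * exp (f x) \<partial>lborel_on a b) + t * K)"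
      by (simp add: algebra_simps power2_eq_square)
    then show ?thesis using t by simp
  qed
  show ?thesis
  proof (rule field_le_epsilon)
    fix e :: real assume e: "e > 0"
    \<comment> \<open>The bound \<open>1 / D\<close> keeps \<open>t * d\<close> within the range of
      the quadratic bound, and \<open>e / (K + 1)\<close> makes the error \<open>t * K\<close> at
      most \<open>e\<close>; adding 1 covers \<open>K = 0\<close>.\<close>
    define t where "t = min (min 1 (1 / D)) (e / (K + 1))"
    have t: "0 < t" "t \<le> 1" "t \<le> 1 / D" "t \<le> e / (K + 1)" using D(1) K e by (auto simp: t_def)
    have "t * D \<le> 1" using t(3) D(1) by (simp add: field_simps)
    moreover have "t * K \<le> e"
    proof -
      have "t * (K + 1) \<le> e" using t(4) K by (simp add: field_simps)
      then show ?thesis using t(1) by (simp add: algebra_simps)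
    qed
    ultimately show "(\<integral>x. d x \<partial>measure_pmf p) \<le> (\<integral>x. d x * exp (f x) \<partial>lborel_on a b) + e"
      using step[of t] t by linarith
  qed
qed

text \<open>Lebesgue integrals determine the functions only in the interior. The atoms of
  \<open>p\<close> at \<open>a\<close> and \<open>b\<close> are what settles the end values.\<close>

lemma maximizer_eqI:
  assumes fin: "finite (set_pmf p)" and ab: "a \<in> set_pmf p" "b \<in> set_pmf p"
    and f: "concave_on {a..b} f" and g: "concave_on {a..b} g"
    and max: "\<And>h. concave_on {a..b} h \<Longrightarrow> log_lik_on p a b h \<le> log_lik_on p a b g"
    and deriv: "\<And>d. concave_on {a..b} (\<lambda>x. f x + d x) \<Longrightarrow>
      (\<integral>x. d x \<partial>measure_pmf p) \<le> (\<integral>x. d x * exp (f x) \<partial>lborel_on a b)"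
    and x: "x \<in> {a..b}"
  shows "f x = g x"
proof -
  note intp = integrable_measure_pmf_finite[OF fin]
  \<comment> \<open>The remainder of \<open>exp\<close> at \<open>g x\<close> after first-order
    expansion around \<open>f x\<close>, nonnegative by convexity. Maximality of \<open>g\<close>
    bounds the difference of the exponential integrals by the \<open>p\<close>-integral of
    \<open>g - f\<close>, and \<open>deriv\<close> bounds that by the integral of
    \<open>(g - f) * exp f\<close>; so \<open>w\<close> has integral at most 0.\<close>
  define w where "w = (\<lambda>x. exp (g x) - exp (f x) - (g x - f x) * exp (f x))"
  have w_eq: "w x = exp (f x) * (exp (g x - f x) - (1 + (g x - f x)))" for x
    by (simp add: w_def algebra_simps flip: exp_add)
  have w_nonneg: "0 \<le> w x" for x
    unfolding w_eq by (intro mult_nonneg_nonneg) (auto simp: exp_ge_add_one_self)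
  have cd: "concave_on {a..b} (\<lambda>x. f x + (g x - f x))" using g by simp
  obtain D where D: "\<And>x. x \<in> {a..b} \<Longrightarrow> \<bar>g x - f x\<bar> \<le> D"
    "(\<lambda>x. g x - f x) \<in> borel_measurable (lborel_on a b)"
    using concave_perturbation_bounded_measurable[OF f cd] by blast
  note ints = integrable_exp_concave[OF f] integrable_exp_concave[OF g]
    integrable_mult_exp_concave[OF f D(2,1)]
  have iw: "integrable (lborel_on a b) w" unfolding w_def using ints by auto
  have "(\<integral>x. w x \<partial>lborel_on a b) = (\<integral>x. exp (g x) \<partial>lborel_on a b) - (\<integral>x. exp (f x) \<partial>lborel_on a b)
      - (\<integral>x. (g x - f x) * exp (f x) \<partial>lborel_on a b)"
    unfolding w_def using ints by simp
  also have "\<dots> \<le> 0"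
    using max[OF f] deriv[OF cd] by (simp add: log_lik_on_def intp)
  finally have "(\<integral>x. w x \<partial>lborel_on a b) = 0"
    using w_nonneg by (simp add: antisym integral_nonneg)
  then have "AE x in lborel_on a b. w x = 0"
    using integral_nonneg_eq_0_iff_AE[OF iw] w_nonneg by simp
  then have AE_eq: "AE x in lborel_on a b. f x = g x"
  proof eventually_elim
    case (elim x)
    then have "exp (g x - f x) = 1 + (g x - f x)" by (simp add: w_eq)
    then show ?case using exp_minus_greater[of "f x - g x"] by simp
  qed
  have interior: "f x = g x" if "x \<in> {a<..<b}" for x
    using continuous_AE_eq_on_interval[OF _ _ AE_eq that] f g concave_on_interval_continuous by blast
  define m where "m = (\<lambda>x. max (f x) (g x))"
  have m: "concave_on {a..b} m"
    unfolding m_def using f g interior by (rule concave_on_max_if_eq_interior)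
  \<comment> \<open>Passing from \<open>g\<close> to \<open>m\<close> leaves the exponential
    integral unchanged, so maximality compares the \<open>p\<close>-integrals alone. Likewise the
    direction \<open>m - f\<close> makes the right-hand side of \<open>deriv\<close> vanish
    below.\<close>
  have "(\<integral>x. exp (m x) \<partial>lborel_on a b) = (\<integral>x. exp (g x) \<partial>lborel_on a b)"
  proof (rule integral_cong_AE)
    show "AE x in lborel_on a b. exp (m x) = exp (g x)"
      using AE_eq by eventually_elim (simp add: m_def)
  qed (use integrable_exp_concave[OF m] ints in auto)
  then have "(\<integral>x. m x - g x \<partial>measure_pmf p) \<le> 0"
    using max[OF m] by (simp add: log_lik_on_def intp)
  then have mg: "m x - g x = 0" if "x \<in> set_pmf p" for x
    using pmf_integral_le_zero[OF fin, of "\<lambda>x. m x - g x"] that by (simp add: m_def)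
  have "AE x in lborel_on a b. (m x - f x) * exp (f x) = 0"
    using AE_eq by eventually_elim (simp add: m_def)
  then have "(\<integral>x. (m x - f x) * exp (f x) \<partial>lborel_on a b) = 0"
    by (rule integral_eq_zero_AE)
  then have "(\<integral>x. m x - f x \<partial>measure_pmf p) \<le> 0"
    using deriv[of "\<lambda>x. m x - f x"] m by simp
  then have mf: "m x - f x = 0" if "x \<in> set_pmf p" for x
    using pmf_integral_le_zero[OF fin, of "\<lambda>x. m x - f x"] that by (simp add: m_def)
  consider "x = a" | "x = b" | "x \<in> {a<..<b}" using x by force
  then show ?thesis
    using mf[OF ab(1)] mg[OF ab(1)] mf[OF ab(2)] mg[OF ab(2)] interior by cases auto
qed

section \<open>Reduction of the maximum likelihood problem to \<open>[X_1, X_n]\<close>\<close>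

lemma log_lik_ext_on:
  assumes "n > 0" "X ` {1..n} \<subseteq> S"
  shows "log_lik n X (ext_on S f) = ereal (\<integral>x. f x \<partial>empirical n X)
    - enn2ereal (\<integral>\<^sup>+x. ennreal (exp_ext (ext_on S f x)) \<partial>lborel)"
proof -
  have "ereal_integral (empirical n X) (ext_on S f) = ereal (\<integral>x. f x \<partial>empirical n X)"
    unfolding empirical_def using assms
    by (intro ereal_integral_pmf_real) (auto simp: ext_on_def set_pmf_of_set)
  then show ?thesis by (simp add: log_lik_def)
qed

lemma log_lik_ext_on_outside:
  assumes "n > 0" "\<not> X ` {1..n} \<subseteq> S"
  shows "log_lik n X (ext_on S f) = -\<infinity>"
proof -
  obtain x where x: "x \<in> X ` {1..n}" "x \<notin> S" using assms by blast
  have "ereal_integral (empirical n X) (ext_on S f) = -\<infinity>"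
    unfolding empirical_def using assms(1) x
    by (intro ereal_integral_pmf_minus_infty[of _ _ x]) (auto simp: ext_on_def set_pmf_of_set)
  \<comment> \<open>In \<open>ereal\<close> this difference is \<open>-\<infinity>\<close> even when
    \<open>y\<close> is infinite.\<close>
  moreover have "-\<infinity> - enn2ereal y = -\<infinity>" for y by (cases y) auto
  ultimately show ?thesis by (simp add: log_lik_def)
qed

lemma log_lik_ext_on_interval:
  assumes "n > 0" "X ` {1..n} \<subseteq> {a..b}" "concave_on {a..b} f"
  shows "log_lik n X (ext_on {a..b} f) = ereal (log_lik_on (pmf_of_set (X ` {1..n})) a b f)"
proof -
  have "0 \<le> (\<integral>x. exp (f x) \<partial>lborel_on a b)" by (rule Bochner_Integration.integral_nonneg) simp
  then show ?thesis
    using log_lik_ext_on[OF assms(1,2), of f]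
    by (simp add: nn_integral_exp_ext_on[OF assms(3)] log_lik_on_def empirical_def enn2ereal_ennreal)
qed

text \<open>A finite criterion puts all observations into the domain \<open>S\<close>, which as an
  interval then contains \<open>[a, b]\<close>. Cutting the maximizer off outside
  \<open>[a, b]\<close> keeps its empirical term, so no mass can lie outside; yet one further point
  of \<open>S\<close> would produce an interval of positive mass.\<close>

lemma mle_ext_on:
  assumes n: "n > 0" and dom: "X ` {1..n} \<subseteq> {a..b}" and ab: "a \<in> X ` {1..n}" "b \<in> X ` {1..n}"
    and mle: "is_log_concave_mle n X \<phi>"
  obtains g where "\<phi> = ext_on {a..b} g" "concave_on {a..b} g"
    "\<And>h. concave_on {a..b} h \<Longrightarrow>
      log_lik_on (pmf_of_set (X ` {1..n})) a b h \<le> log_lik_on (pmf_of_set (X ` {1..n})) a b g"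
proof -
  define S where "S = {x. \<phi> x > -\<infinity>}"
  have \<phi>: "concave_ext \<phi>" and max: "\<And>\<psi>. concave_ext \<psi> \<Longrightarrow> log_lik n X \<psi> \<le> log_lik n X \<phi>"
    using mle by (auto simp: is_log_concave_mle_def)
  obtain g where \<phi>_eq: "\<phi> = ext_on S g" and gS: "concave_on S g"
    using concave_extE[OF \<phi>] unfolding S_def by blast
  have max_interval: "ereal (log_lik_on (pmf_of_set (X ` {1..n})) a b h) \<le> log_lik n X (ext_on S g)"
    if "concave_on {a..b} h" for h
    using max[of "ext_on {a..b} h"] that log_lik_ext_on_interval[OF n dom that]
    by (simp add: concave_ext_ext_on flip: \<phi>_eq)
  \<comment> \<open>The zero function is a competitor with a finite criterion value.\<close>
  have "concave_on {a..b} (\<lambda>x. 0)" by (simp add: concave_on_const)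
  from max_interval[OF this] have not_bot: "log_lik n X (ext_on S g) \<noteq> -\<infinity>" by auto
  have XS: "X ` {1..n} \<subseteq> S"
    using log_lik_ext_on_outside[OF n] not_bot by blast
  have S: "is_interval S"
    using concave_ext_convex_dom[OF \<phi>] by (simp add: S_def is_interval_convex_1)
  have abS: "{a..b} \<subseteq> S"
    using S XS ab unfolding is_interval_1 by (meson atLeastAtMost_iff subset_eq)
  have g: "concave_on {a..b} g"
    using gS abS unfolding concave_on_def by (rule convex_on_subset) simp
  define J where "J = (\<integral>x. exp (g x) \<partial>lborel_on a b)"
  define N where "N = (\<integral>\<^sup>+x. ennreal (exp_ext (ext_on S g x)) \<partial>lborel)"
  have J: "J \<ge> 0" unfolding J_def by (rule Bochner_Integration.integral_nonneg) simp
  \<comment> \<open>The competitor is \<open>g\<close> itself, cut off outside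
    \<open>[a, b]\<close>.\<close>
  have "ereal ((\<integral>x. g x \<partial>empirical n X) - J) \<le> ereal (\<integral>x. g x \<partial>empirical n X) - enn2ereal N"
    using max_interval[OF g] log_lik_ext_on[OF n XS, of g]
    by (simp add: log_lik_on_def J_def N_def empirical_def)
  then have NJ: "N \<le> ennreal J"
    using J by (cases N) (auto simp: enn2ereal_ennreal ennreal_leI)
  \<comment> \<open>Such a set \<open>A\<close> would contribute at least \<open>exp m\<close> times
    its positive measure on top of \<open>J\<close>, against \<open>NJ\<close>.\<close>
  have no_excess: False if "A \<in> sets lborel" "emeasure lborel A > 0" "A \<inter> {a..b} = {}"
    "\<And>x. x \<in> A \<Longrightarrow> x \<in> S \<and> m \<le> g x" for A m
  proof -
    note [measurable] = that(1)
    have [measurable]: "(\<lambda>x. exp_ext (ext_on {a..b} g x)) \<in> borel_measurable borel"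
    proof -
      have "(\<lambda>x. exp_ext (ext_on {a..b} g x)) = (\<lambda>x. indicator {a..b} x *\<^sub>R exp (g x))"
        by (auto simp: exp_ext_def ext_on_def indicator_def)
      moreover have "(\<lambda>x. exp (g x)) \<in> borel_measurable (lborel_on a b)"
        using concave_on_interval_measurable[OF g] by measurable
      ultimately show ?thesis
        by (subst (asm) borel_measurable_restrict_space_iff) auto
    qed
    have "ennreal J + ennreal (exp m) * emeasure lborel A
        = (\<integral>\<^sup>+x. ennreal (exp_ext (ext_on {a..b} g x)) + ennreal (exp m) * indicator A x \<partial>lborel)"
      using that(1)
      by (subst nn_integral_add) (auto simp: nn_integral_exp_ext_on[OF g] J_def nn_integral_cmult)
    also have "\<dots> \<le> N"
      unfolding N_def
    proof (rule nn_integral_mono)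
      fix x
      show "ennreal (exp_ext (ext_on {a..b} g x)) + ennreal (exp m) * indicator A x
          \<le> ennreal (exp_ext (ext_on S g x))"
        using that(3) that(4)[of x] abS
        by (cases "x \<in> A"; cases "x \<in> {a..b}") (auto simp: exp_ext_def ext_on_def ennreal_leI)
    qed
    also have "\<dots> \<le> ennreal J" by (rule NJ)
    finally show False
      using that(2) by (simp add: ennreal_add_left_cancel_le flip: top.not_eq_extremum)
  qed
  have "S = {a..b}"
  proof (rule ccontr)
    assume "S \<noteq> {a..b}"
    then obtain y where y: "y \<in> S" "y \<notin> {a..b}" using abS by blast
    \<comment> \<open>This treats both sides at once: either \<open>l = y\<close> and
      \<open>u = b\<close>, or \<open>l = a\<close> and \<open>u = y\<close>, so exactly one of the
      two gaps is nonempty. Concavity on \<open>[l, u]\<close> bounds \<open>g\<close> below by its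
      smaller end value.\<close>
    define l u where "l = min y a" and "u = max y b"
    have "l \<in> S" "u \<in> S" using y XS ab by (auto simp: l_def u_def min_def max_def)
    then have lu: "{l..u} \<subseteq> S" using S unfolding is_interval_1 by (meson atLeastAtMost_iff subset_eq)
    have glu: "concave_on {l..u} g"
      using gS lu unfolding concave_on_def by (rule convex_on_subset) simp
    have "a \<le> b" using dom ab by auto
    show False
    proof (rule no_excess)
      show "{l<..<a} \<union> {b<..<u} \<in> sets lborel" by simp
      show "({l<..<a} \<union> {b<..<u}) \<inter> {a..b} = {}" by auto
      show "emeasure lborel ({l<..<a} \<union> {b<..<u}) > 0"
        using y \<open>a \<le> b\<close> by (cases "y < a") (auto simp: l_def u_def min_def max_def)
      show "x \<in> S \<and> min (g l) (g u) \<le> g x" if "x \<in> {l<..<a} \<union> {b<..<u}" for x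
        using concave_on_interval_ge_min[OF glu, of x] lu that \<open>a \<le> b\<close>
        by (auto simp: l_def u_def)
    qed
  qed
  with \<phi>_eq have \<phi>_ab: "\<phi> = ext_on {a..b} g" by simp
  show thesis
  proof (rule that[OF \<phi>_ab g])
    fix h assume "concave_on {a..b} h"
    from max_interval[OF this]
    show "log_lik_on (pmf_of_set (X ` {1..n})) a b h \<le> log_lik_on (pmf_of_set (X ` {1..n})) a b g"
      using log_lik_ext_on_interval[OF n dom g] \<phi>_eq \<phi>_ab by simp
  qed
qed

section \<open>The characterization of the estimator\<close>

lemma integral_mult_exp_ext_on:
  "(\<integral>x. d x * exp_ext (ext_on {a..b} f x) \<partial>lborel) = (\<integral>x. d x * exp (f x) \<partial>lborel_on a b)"
  \<comment> \<open>The restricted Bochner integral equals the integral with an indicator for every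
    \<open>d\<close>: if one integrand is not integrable, neither is the other, and both integrals
    are 0.\<close>
  by (subst integral_restrict_space)
    (auto intro!: Bochner_Integration.integral_cong simp: exp_ext_def ext_on_def indicator_def)

theorem theorem2p2:
  fixes n :: nat and X :: "nat \<Rightarrow> real" and \<phi>hat \<phi>tilde :: "real \<Rightarrow> ereal"
  assumes "n > 1"
    and "strict_mono_on {1..n} X"
    and "is_log_concave_mle n X \<phi>hat"
    and "concave_ext \<phi>tilde"
    and "{x. \<phi>tilde x > -\<infinity>} = {X 1..X n}"
  shows "\<phi>tilde = \<phi>hat \<longleftrightarrow>
    (\<forall>\<Delta> :: real \<Rightarrow> real.
       (\<exists>c>0. concave_ext (\<lambda>x. \<phi>tilde x + ereal (c * \<Delta> x))) \<longrightarrow>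
       (\<integral>x. \<Delta> x \<partial>empirical n X) \<le> (\<integral>x. \<Delta> x * exp_ext (\<phi>tilde x) \<partial>lborel))"
proof -
  define a b where "a = X 1" and "b = X n"
  define p where "p = pmf_of_set (X ` {1..n})"
  have n: "n > 0" using assms(1) by simp
  have fin: "finite (set_pmf p)" and p: "set_pmf p = X ` {1..n}"
    using n by (simp_all add: p_def set_pmf_of_set)
  have ab: "a \<in> X ` {1..n}" "b \<in> X ` {1..n}" using n by (auto simp: a_def b_def)
  have dom: "X ` {1..n} \<subseteq> {a..b}"
    using strict_mono_on_leD[OF assms(2)] n by (auto simp: a_def b_def)
  obtain f where f_eq: "\<phi>tilde = ext_on {a..b} f" and f: "concave_on {a..b} f"
    using concave_extE[OF assms(4)] unfolding assms(5) a_def b_def by blast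
  obtain g where g_eq: "\<phi>hat = ext_on {a..b} g" and g: "concave_on {a..b} g"
    and max: "\<And>h. concave_on {a..b} h \<Longrightarrow> log_lik_on p a b h \<le> log_lik_on p a b g"
    using mle_ext_on[OF n dom ab assms(3)] unfolding p_def by blast
  \<comment> \<open>A real-valued perturbation leaves the domain unchanged, so its concavity is a
    matter of real functions on \<open>[a, b]\<close>.\<close>
  have "(\<lambda>x. \<phi>tilde x + ereal (d x)) = ext_on {a..b} (\<lambda>x. f x + d x)" for d
    by (auto simp: f_eq ext_on_def)
  then have perturb: "concave_ext (\<lambda>x. \<phi>tilde x + ereal (d x)) \<longleftrightarrow> concave_on {a..b} (\<lambda>x. f x + d x)" for d
    by (simp add: concave_ext_ext_on)
  have int: "(\<integral>x. d x * exp_ext (\<phi>tilde x) \<partial>lborel) = (\<integral>x. d x * exp (f x) \<partial>lborel_on a b)" for d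
    unfolding f_eq by (rule integral_mult_exp_ext_on)
  have emp: "empirical n X = measure_pmf p" by (simp add: empirical_def p_def)
  show ?thesis
    unfolding perturb int emp
  proof (intro iffI allI impI)
    fix d :: "real \<Rightarrow> real"
    assume eq: "\<phi>tilde = \<phi>hat" and "\<exists>c>0. concave_on {a..b} (\<lambda>x. f x + c * d x)"
    then obtain c where c: "c > 0" "concave_on {a..b} (\<lambda>x. f x + c * d x)" by blast
    \<comment> \<open>The extensions determine \<open>f\<close> and \<open>g\<close> only on
      \<open>[a, b]\<close>. That interval carries both integrals of the criterion, so maximality
      passes from \<open>g\<close> to \<open>f\<close>.\<close>
    have fg: "f x = g x" if "x \<in> {a..b}" for x
      using fun_cong[OF eq, of x] that by (simp add: f_eq g_eq ext_on_def)
    have "(\<integral>x. f x \<partial>measure_pmf p) = (\<integral>x. g x \<partial>measure_pmf p)"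
      using fg dom p by (intro integral_cong_AE) (auto simp: AE_measure_pmf_iff)
    moreover have "(\<integral>x. exp (f x) \<partial>lborel_on a b) = (\<integral>x. exp (g x) \<partial>lborel_on a b)"
      using fg by (intro Bochner_Integration.integral_cong) (auto simp: space_restrict_space)
    ultimately have "log_lik_on p a b g = log_lik_on p a b f"
      by (simp add: log_lik_on_def)
    \<comment> \<open>The derivative inequality is used in the direction \<open>c * d\<close>; the
      positive factor \<open>c\<close> then cancels.\<close>
    then have "(\<integral>x. c * d x \<partial>measure_pmf p) \<le> (\<integral>x. c * d x * exp (f x) \<partial>lborel_on a b)"
      using maximizer_directional_derivative_le[OF fin f _ c(2)] max by simp
    then show "(\<integral>x. d x \<partial>measure_pmf p) \<le> (\<integral>x. d x * exp (f x) \<partial>lborel_on a b)"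
      using c(1) by (simp add: mult.assoc)
  next
    assume *: "\<forall>d. (\<exists>c>0. concave_on {a..b} (\<lambda>x. f x + c * d x)) \<longrightarrow>
      (\<integral>x. d x \<partial>measure_pmf p) \<le> (\<integral>x. d x * exp (f x) \<partial>lborel_on a b)"
    \<comment> \<open>The hypothesis is used with \<open>c = 1\<close>, since the directions
      compared in \<open>maximizer_eqI\<close> are differences of concave functions.\<close>
    have deriv: "(\<integral>x. d x \<partial>measure_pmf p) \<le> (\<integral>x. d x * exp (f x) \<partial>lborel_on a b)"
      if "concave_on {a..b} (\<lambda>x. f x + d x)" for d
      using *[rule_format, of d] that by (metis (no_types, lifting) ext mult_1 zero_less_one)
    show "\<phi>tilde = \<phi>hat"
      unfolding f_eq g_eq
      using maximizer_eqI[OF fin _ _ f g max deriv] ab p by (intro ext_on_cong) blast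
  qed
qed

end
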